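(* Given a file of size $F>0$, the expected transfer time of the static policy in the (Markovian) channel $i\in\mathcal{N}$ is $$\mathbb{E}[T(i,F)]=\Delta\left(\left(k_i+\mathbf{1}_{\{\alpha_i>0\}}-1\right)\frac{q_{i,0}}{q_{i,1}}+\frac{1-c_i}{q_{i,1}}\right)+\frac{F}{r_i},$$ where $k_i=\lfloor F/(\Delta r_i)\rfloor$ and $\alpha_i=F/(\Delta r_i)-k_i\in[0,1)$.
   Context: Let $\mathcal{N}=\{1,\dots,N\}$ be a finite set of channels, $\Delta>0$ a fixed slot duration, and for each $i\in\mathcal{N}$ let $r_i>0$ be the rate of channel $i$. For each $i$, $\{Y_i(k)\}_{k\ge 0}$ is a two-state Markov chain on $\{0,1\}$ ($1$ = available, $0$ = unavailable) with transition probabilities $P(Y_i(k+1)=1\mid Y_i(k)=0)=q_{i,1}\in(0,1]$ and $P(Y_i(k+1)=0\mid Y_i(k)=1)=q_{i,0}\in[0,1]$, and arbitrary initial distribution $P(Y_i(0)=1)=c_i\in[0,1]$. The state of channel $i$ at time $t\ge 0$ is $X_i(t)=Y_i(\lfloor t/\Delta\rfloor)$. The static policy for channel $i$ uses channel $i$ at all times; its transfer time for a file of size $F>0$ is $$T(i,F)=\min\left\{T\ge 0:\int_0^T r_iX_i(t)\,dt\ge F\right\}.$$ $\mathbf{1}_{\{\cdot\}}$ denotes the indicator. *)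

theory Defs
  imports "HOL-Probability.Probability"
begin

text \<open>
  A stochastic process \<open>Y\<close> with values in a countable set \<open>S\<close> is a (discrete-time) Markov chain.
  Conditioning is restricted to events of positive probability, because \<^const>\<open>cond_prob\<close>
  is \<open>0\<close> when the condition has probability \<open>0\<close>.
\<close>

definition markov_chain :: "'a measure \<Rightarrow> 's set \<Rightarrow> (nat \<Rightarrow> 'a \<Rightarrow> 's) \<Rightarrow> bool" where
  "markov_chain M S Y \<longleftrightarrow>
     prob_space M \<and> countable S \<and>
     (\<forall>k. Y k \<in> M \<rightarrow>\<^sub>M count_space S) \<and>
     (\<forall>k y s. (\<forall>j\<le>k. y j \<in> S) \<longrightarrow> s \<in> S \<longrightarrow>
        \<P>(\<omega> in M. \<forall>j\<le>k. Y j \<omega> = y j) > 0 \<longrightarrow>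
        \<P>(\<omega> in M. Y (Suc k) \<omega> = s \<bar> \<forall>j\<le>k. Y j \<omega> = y j) =
        \<P>(\<omega> in M. Y (Suc k) \<omega> = s \<bar> Y k \<omega> = y k))"

text \<open>
  Two-state chain on \<open>{0, 1}\<close>: \<open>q 1\<close> and \<open>q 0\<close> are the probabilities of moving \<^emph>\<open>to\<close> \<open>1\<close> (from \<open>0\<close>)
  and \<^emph>\<open>to\<close> \<open>0\<close> (from \<open>1\<close>) respectively, and \<open>c\<close> is the probability of starting in \<open>1\<close>.
\<close>

definition two_state_chain ::
    "'a measure \<Rightarrow> (nat \<Rightarrow> real) \<Rightarrow> real \<Rightarrow> (nat \<Rightarrow> 'a \<Rightarrow> nat) \<Rightarrow> bool" where
  "two_state_chain M q c Y \<longleftrightarrow>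
     markov_chain M {0, 1} Y \<and>
     \<P>(\<omega> in M. Y 0 \<omega> = 1) = c \<and>
     (\<forall>k. \<P>(\<omega> in M. Y k \<omega> = 0) > 0 \<longrightarrow>
        \<P>(\<omega> in M. Y (Suc k) \<omega> = 1 \<bar> Y k \<omega> = 0) = q 1) \<and>
     (\<forall>k. \<P>(\<omega> in M. Y k \<omega> = 1) > 0 \<longrightarrow>
        \<P>(\<omega> in M. Y (Suc k) \<omega> = 0 \<bar> Y k \<omega> = 1) = q 0)"

definition channel_state :: "real \<Rightarrow> (nat \<Rightarrow> 'a \<Rightarrow> nat) \<Rightarrow> real \<Rightarrow> 'a \<Rightarrow> nat" where
  "channel_state \<Delta> Y t \<omega> = Y (nat \<lfloor>t / \<Delta>\<rfloor>) \<omega>"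

definition transferred :: "real \<Rightarrow> real \<Rightarrow> (nat \<Rightarrow> 'a \<Rightarrow> nat) \<Rightarrow> 'a \<Rightarrow> real \<Rightarrow> real" where
  "transferred \<Delta> \<rho> Y \<omega> T = integral {0..T} (\<lambda>t. \<rho> * real (channel_state \<Delta> Y t \<omega>))"

text \<open>
  The transfer time is \<open>\<infinity>\<close> on outcomes where the file is never transferred. On all other outcomes
  the minimum is attained, since the amount transferred is continuous in \<open>T\<close>.
\<close>

definition transfer_time :: "real \<Rightarrow> real \<Rightarrow> (nat \<Rightarrow> 'a \<Rightarrow> nat) \<Rightarrow> real \<Rightarrow> 'a \<Rightarrow> ennreal" where
  "transfer_time \<Delta> \<rho> Y F \<omega> =
     (if \<exists>T\<ge>0. transferred \<Delta> \<rho> Y \<omega> T \<ge> F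
      then ennreal (LEAST T. T \<ge> 0 \<and> transferred \<Delta> \<rho> Y \<omega> T \<ge> F)
      else \<infinity>)"

end

theory Submission imports Defs begin

text \<open>
  The channel carries \<open>\<Delta> * \<rho>\<close> units of data per available slot and nothing in an unavailable one,
  so the transfer always costs exactly \<open>F / \<rho>\<close> of available time, and the only random part is the
  time wasted in unavailable slots. With \<open>m + 1 = \<lceil>F / (\<Delta> * \<rho>)\<rceil>\<close>, the file is completed during the
  \<open>(m + 1)\<close>-st available slot, so a slot \<open>j\<close> is wasted precisely if \<open>Y j = 0\<close> and at most \<open>m\<close> of the
  slots before \<open>j\<close> were available. Hence \<open>T = F / \<rho> + \<Delta> * Z\<close> on every outcome, where \<open>Z\<close> counts
  the wasted slots (\<open>transfer_time_eq_wasted_slots\<close>); on outcomes where the file is never completed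
  both sides are infinite.

  To compute the expectation of \<open>Z\<close>, the wasted slots are grouped by the number \<open>l\<close> of available
  slots that precede them. The initial unavailable period (\<open>l = 0\<close>) is non-empty with probability
  \<open>1 - c\<close>; for \<open>1 \<le> l \<le> m\<close> the period after the \<open>l\<close>-th available slot is non-empty with probability
  \<open>q 0\<close>; and once begun, a period has a geometric length with mean \<open>1 / q 1\<close>. Instead of
  stopping times, the proof uses the probabilities \<open>P(Y j = y, l ones before j)\<close>. The Markov property
  (\<open>markov_chain_history\<close>) gives linear recurrences for them in \<open>j\<close>
  (\<open>state_ones_prob_Suc\<close>), and summing these over \<open>j\<close> (\<open>sums_linear_recurrence\<close>) turns
  them into a recursion in \<open>l\<close> that is solved by induction (\<open>state_ones_prob_sums\<close>).
\<close>

section \<open>The transfer time along one outcome\<close>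

definition ones_before :: "(nat \<Rightarrow> 'a \<Rightarrow> nat) \<Rightarrow> nat \<Rightarrow> 'a \<Rightarrow> nat" where
  "ones_before Y n \<omega> = (\<Sum>j<n. Y j \<omega>)"

lemma ones_before_0 [simp]: "ones_before Y 0 \<omega> = 0"
  by (simp add: ones_before_def)

lemma ones_before_Suc: "ones_before Y (Suc n) \<omega> = ones_before Y n \<omega> + Y n \<omega>"
  by (simp add: ones_before_def)

lemma ones_before_mono: "m \<le> n \<Longrightarrow> ones_before Y m \<omega> \<le> ones_before Y n \<omega>"
  unfolding ones_before_def by (intro sum_mono2) auto

text \<open>
  The channel state is constant on a slot except at its right end point, which already belongs to
  the next slot; a single point does not affect the integral.
\<close>

lemma has_integral_channel_state_slot:
  assumes \<Delta>: "\<Delta> > 0" and T: "real n * \<Delta> \<le> T" "T \<le> real (Suc n) * \<Delta>"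
  shows "((\<lambda>t. \<rho> * real (channel_state \<Delta> Y t \<omega>)) has_integral
           \<rho> * real (Y n \<omega>) * (T - real n * \<Delta>)) {real n * \<Delta>..T}"
proof -
  have "((\<lambda>t. \<rho> * real (Y n \<omega>)) has_integral
           (T - real n * \<Delta>) *\<^sub>R (\<rho> * real (Y n \<omega>))) {real n * \<Delta>..T}"
    using T has_integral_const_real[of "\<rho> * real (Y n \<omega>)" "real n * \<Delta>" T] by simp
  then show ?thesis
  proof (rule has_integral_spike_finite[where S = "{real (Suc n) * \<Delta>}", rotated 2, THEN has_integral_eq_rhs])
    fix t assume t: "t \<in> {real n * \<Delta>..T} - {real (Suc n) * \<Delta>}"
    have "real n \<le> t / \<Delta>" "t / \<Delta> < real (Suc n)"
      using t T \<Delta> by (auto simp: field_simps)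
    then have "\<lfloor>t / \<Delta>\<rfloor> = int n" by (intro floor_unique) auto
    then show "\<rho> * real (channel_state \<Delta> Y t \<omega>) = \<rho> * real (Y n \<omega>)"
      by (simp add: channel_state_def)
  qed (auto simp: mult_ac)
qed

lemma has_integral_channel_state:
  assumes \<Delta>: "\<Delta> > 0"
  shows "((\<lambda>t. \<rho> * real (channel_state \<Delta> Y t \<omega>)) has_integral
           \<rho> * \<Delta> * real (ones_before Y n \<omega>)) {0..real n * \<Delta>}"
proof (induction n)
  case (Suc n)
  have "((\<lambda>t. \<rho> * real (channel_state \<Delta> Y t \<omega>)) has_integral
           \<rho> * \<Delta> * real (ones_before Y n \<omega>)
           + \<rho> * real (Y n \<omega>) * (real (Suc n) * \<Delta> - real n * \<Delta>)) {0..real (Suc n) * \<Delta>}"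
    using \<Delta> by (intro has_integral_combine[OF _ _ Suc.IH has_integral_channel_state_slot]) auto
  then show ?case by (simp add: ones_before_Suc algebra_simps)
qed (use has_integral_refl(2)[of _ "0::real"] in simp)

lemma transferred_eq:
  assumes \<Delta>: "\<Delta> > 0" and T: "real n * \<Delta> \<le> T" "T \<le> real (Suc n) * \<Delta>"
  shows "transferred \<Delta> \<rho> Y \<omega> T =
           \<rho> * (\<Delta> * real (ones_before Y n \<omega>) + real (Y n \<omega>) * (T - real n * \<Delta>))"
proof -
  have "((\<lambda>t. \<rho> * real (channel_state \<Delta> Y t \<omega>)) has_integral
           \<rho> * \<Delta> * real (ones_before Y n \<omega>) + \<rho> * real (Y n \<omega>) * (T - real n * \<Delta>)) {0..T}"
    using \<Delta> T
    by (intro has_integral_combine[OF _ _ has_integral_channel_state has_integral_channel_state_slot])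
       auto
  then show ?thesis
    unfolding transferred_def by (subst integral_unique) (auto simp: algebra_simps)
qed

text \<open>
  The amount transferred grows with time. Comparing with the end of a slot is enough to see that an
  earlier time than the claimed minimum does not suffice.
\<close>

lemma transferred_le:
  assumes "\<Delta> > 0" "\<rho> > 0" "0 \<le> T" "T \<le> real n * \<Delta>"
  shows "transferred \<Delta> \<rho> Y \<omega> T \<le> \<rho> * \<Delta> * real (ones_before Y n \<omega>)"
proof (cases "T = real n * \<Delta>")
  case True
  then show ?thesis using assms transferred_eq[of \<Delta> n T \<rho> Y \<omega>] by simp
next
  case False
  define j where "j = nat \<lfloor>T / \<Delta>\<rfloor>"
  have "real j \<le> T / \<Delta>" "T / \<Delta> \<le> real (Suc j)"
    unfolding j_def using assms by (auto simp: le_nat_iff nat_le_iff) linarith+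
  then have j: "real j * \<Delta> \<le> T" "T \<le> real (Suc j) * \<Delta>"
    using assms by (auto simp: field_simps)
  have "real j * \<Delta> < real n * \<Delta>" using j False assms by linarith
  then have "Suc j \<le> n" using assms by simp
  have "real (Y j \<omega>) * (T - real j * \<Delta>) \<le> real (Y j \<omega>) * \<Delta>"
    using j by (intro mult_left_mono) (auto simp: algebra_simps)
  then have "transferred \<Delta> \<rho> Y \<omega> T \<le> \<rho> * (\<Delta> * real (ones_before Y (Suc j) \<omega>))"
    unfolding transferred_eq[OF assms(1) j] ones_before_Suc
    using assms by (intro mult_left_mono) (auto simp: algebra_simps)
  also have "\<dots> \<le> \<rho> * (\<Delta> * real (ones_before Y n \<omega>))"
    using assms ones_before_mono[OF \<open>Suc j \<le> n\<close>, of Y \<omega>] by (intro mult_left_mono) auto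
  finally show ?thesis by (simp add: mult_ac)
qed

text \<open>
  Slot \<open>n\<close> is the \<open>(m + 1)\<close>-st available slot. It starts with \<open>real m * (\<Delta> * \<rho>) < F\<close> units transferred, and
  its own \<open>\<Delta> * \<rho>\<close> units suffice for the rest.
\<close>

lemma transfer_time_attained:
  assumes "\<Delta> > 0" "\<rho> > 0"
    and m: "real m * (\<Delta> * \<rho>) < F" "F \<le> real (Suc m) * (\<Delta> * \<rho>)"
    and n: "ones_before Y n \<omega> = m" "Y n \<omega> = 1"
  shows "transfer_time \<Delta> \<rho> Y F \<omega> = ennreal (F / \<rho> + \<Delta> * (real n - real m))"
proof -
  define T where "T = F / \<rho> + \<Delta> * (real n - real m)"
  have lo: "real m * \<Delta> < F / \<rho>" and hi: "F / \<rho> \<le> real (Suc m) * \<Delta>"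
    using m assms(1,2) by (auto simp: field_simps)
  have T: "real n * \<Delta> < T" "T \<le> real (Suc n) * \<Delta>"
    using lo hi by (auto simp: T_def algebra_simps)
  have "0 \<le> real n * \<Delta>" using assms(1) by simp
  then have T0: "T \<ge> 0" using T by linarith
  have slot: "transferred \<Delta> \<rho> Y \<omega> T' = F - \<rho> * (T - T')"
    if "real n * \<Delta> \<le> T'" "T' \<le> T" for T'
    using transferred_eq[of \<Delta> n T' \<rho> Y \<omega>] that T n assms(1,2)
    by (simp add: T_def algebra_simps)
  have TF: "transferred \<Delta> \<rho> Y \<omega> T = F" using slot[of T] T by simp
  have "T \<le> T'" if T': "T' \<ge> 0" "transferred \<Delta> \<rho> Y \<omega> T' \<ge> F" for T'
  proof (rule ccontr)
    assume "\<not> T \<le> T'"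
    then have less: "T' < T" by simp
    show False
    proof (cases "real n * \<Delta> \<le> T'")
      case True
      then show False using slot[of T'] mult_pos_pos[of \<rho> "T - T'"] less T'(2) assms(2) by linarith
    next
      case False
      then show False
        using transferred_le[OF assms(1,2) T'(1), of n Y \<omega>] T'(2) m n by (simp add: mult_ac)
    qed
  qed
  then have "(LEAST T. T \<ge> 0 \<and> transferred \<Delta> \<rho> Y \<omega> T \<ge> F) = T"
    using T0 TF by (intro Least_equality) auto
  then show ?thesis
    unfolding transfer_time_def T_def[symmetric] using T0 TF by auto
qed

lemma transfer_time_infinite:
  assumes "\<Delta> > 0" "\<rho> > 0" and m: "real m * (\<Delta> * \<rho>) < F"
    and le: "\<And>n. ones_before Y n \<omega> \<le> m"
  shows "transfer_time \<Delta> \<rho> Y F \<omega> = \<infinity>"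
proof -
  have "transferred \<Delta> \<rho> Y \<omega> T < F" if "T \<ge> 0" for T
  proof -
    obtain n where "T / \<Delta> \<le> real n" using real_arch_simple by blast
    then have "T \<le> real n * \<Delta>" using assms(1) by (simp add: field_simps)
    then have "transferred \<Delta> \<rho> Y \<omega> T \<le> \<rho> * \<Delta> * real (ones_before Y n \<omega>)"
      using assms that by (intro transferred_le) auto
    also have "\<dots> \<le> \<rho> * \<Delta> * real m" using assms by (intro mult_left_mono) auto
    finally show ?thesis using m by (simp add: mult_ac)
  qed
  then show ?thesis unfolding transfer_time_def by (auto simp: not_le[symmetric])
qed

lemma count_zeros:
  assumes "\<And>j. Y j \<omega> \<in> {0, 1}"
  shows "(\<Sum>j<n. of_bool (Y j \<omega> = 0)) + ones_before Y n \<omega> = n"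
proof (induction n)
  case (Suc n)
  then show ?case using assms[of n] by (auto simp: ones_before_Suc)
qed simp

text \<open>
  If slot \<open>n\<close> is the \<open>(m + 1)\<close>-st available one, the wasted slots are the zeros before \<open>n\<close>, and there
  are \<open>n - m\<close> of them. If there is no such slot, all zeros are wasted and there are infinitely many.
  Stating the count as an infinite series covers both cases and makes measurability immediate.
\<close>

lemma transfer_time_eq_wasted_slots:
  assumes "\<Delta> > 0" "\<rho> > 0"
    and m: "real m * (\<Delta> * \<rho>) < F" "F \<le> real (Suc m) * (\<Delta> * \<rho>)"
    and Y: "\<And>j. Y j \<omega> \<in> {0, 1}"
  shows "transfer_time \<Delta> \<rho> Y F \<omega> =
    ennreal (F / \<rho>) + ennreal \<Delta> * (\<Sum>j. of_bool (Y j \<omega> = 0 \<and> ones_before Y j \<omega> \<le> m))"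
proof (cases "\<exists>n. ones_before Y n \<omega> = m \<and> Y n \<omega> = 1")
  case True
  then obtain n where n: "ones_before Y n \<omega> = m" "Y n \<omega> = 1" by blast
  have cnt: "(\<Sum>j<n. of_bool (Y j \<omega> = 0)) = n - m" and mn: "m \<le> n"
    using count_zeros[of Y \<omega> n] Y n by auto
  have before: "ones_before Y j \<omega> \<le> m" if "j < n" for j
    using ones_before_mono[of j n Y \<omega>] n that by simp
  have after: "\<not> (Y j \<omega> = 0 \<and> ones_before Y j \<omega> \<le> m)" if "j \<ge> n" for j
  proof (cases "j = n")
    case False
    then show ?thesis using ones_before_mono[of "Suc n" j Y \<omega>] n that by (simp add: ones_before_Suc)
  qed (use n in simp)
  have "(\<Sum>j. of_bool (Y j \<omega> = 0 \<and> ones_before Y j \<omega> \<le> m) :: ennreal) =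
          (\<Sum>j<n. of_bool (Y j \<omega> = 0 \<and> ones_before Y j \<omega> \<le> m))"
    using after by (intro suminf_finite) auto
  also have "\<dots> = (\<Sum>j<n. of_nat (of_bool (Y j \<omega> = 0)))"
    using before by (intro sum.cong) auto
  also have "\<dots> = of_nat (n - m)" by (simp only: of_nat_sum[symmetric] cnt)
  also have "\<dots> = ennreal (real n - real m)"
    using mn by (simp add: ennreal_of_nat_eq_real_of_nat of_nat_diff)
  finally have Z: "(\<Sum>j. of_bool (Y j \<omega> = 0 \<and> ones_before Y j \<omega> \<le> m)) = ennreal (real n - real m)" .
  have "0 \<le> real m * (\<Delta> * \<rho>)" using assms by simp
  then have "F > 0" using m by linarith
  then show ?thesis
    unfolding Z transfer_time_attained[OF assms(1,2) m n]
    using mn assms(1,2) by (simp add: ennreal_plus ennreal_mult)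
next
  case False
  have le: "ones_before Y n \<omega> \<le> m" for n
  proof (induction n)
    case (Suc n)
    then show ?case using False Y[of n] by (cases "ones_before Y n \<omega> = m") (auto simp: ones_before_Suc)
  qed simp
  have "of_nat N \<le> (\<Sum>j. of_bool (Y j \<omega> = 0 \<and> ones_before Y j \<omega> \<le> m) :: ennreal)" for N
  proof -
    have "N \<le> (\<Sum>j<N + m. of_bool (Y j \<omega> = 0))"
      using count_zeros[of Y \<omega> "N + m", OF Y] le[of "N + m"] by linarith
    then have "of_nat N \<le> (of_nat (\<Sum>j<N + m. of_bool (Y j \<omega> = 0)) :: ennreal)"
      by (simp only: of_nat_le_iff)
    also have "\<dots> = (\<Sum>j<N + m. of_bool (Y j \<omega> = 0 \<and> ones_before Y j \<omega> \<le> m))"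
      using le by simp
    also have "\<dots> \<le> (\<Sum>j. of_bool (Y j \<omega> = 0 \<and> ones_before Y j \<omega> \<le> m))"
      by (rule sum_le_suminf) auto
    finally show ?thesis .
  qed
  then have Z: "(\<Sum>j. of_bool (Y j \<omega> = 0 \<and> ones_before Y j \<omega> \<le> m) :: ennreal) = \<top>"
    by (metis ennreal_Ex_less_of_nat not_le top.not_eq_extremum)
  show ?thesis
    unfolding Z transfer_time_infinite[OF assms(1,2) m(1) le]
    using assms(1) by (simp add: ennreal_mult_top)
qed

section \<open>Conditioning on an event of the past\<close>

text \<open>
  The definition of a Markov chain conditions on one complete history at a time. An event of the past
  is a finite disjoint union of such histories, and those with \<open>Y k = y\<close> all share the same
  transition probability, so summing over them gives the Markov property for the event.
\<close>

lemma markov_chain_history: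
  fixes Y :: "nat \<Rightarrow> 'a \<Rightarrow> 's"
  assumes mc: "markov_chain M S Y" and S: "finite S" and s: "s \<in> S"
  shows "\<P>(\<omega> in M. Y (Suc k) \<omega> = s \<and> Y k \<omega> = y \<and> (\<lambda>j\<in>{..k}. Y j \<omega>) \<in> H) =
         \<P>(\<omega> in M. Y (Suc k) \<omega> = s \<bar> Y k \<omega> = y) *
         \<P>(\<omega> in M. Y k \<omega> = y \<and> (\<lambda>j\<in>{..k}. Y j \<omega>) \<in> H)"
proof -
  interpret prob_space M using mc by (simp add: markov_chain_def)
  have Ym [measurable]: "Y k \<in> M \<rightarrow>\<^sub>M count_space S" for k
    using mc by (simp add: markov_chain_def)
  have YS: "Y j \<omega> \<in> S" if "\<omega> \<in> space M" for j \<omega>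
    using measurable_space[OF Ym that] by simp
  let ?p = "\<P>(\<omega> in M. Y (Suc k) \<omega> = s \<bar> Y k \<omega> = y)"
  define D where "D = {h \<in> {..k} \<rightarrow>\<^sub>E S. h \<in> H \<and> h k = y}"
  have finD: "finite D" unfolding D_def using S finite_PiE[of "{..k}" "\<lambda>_. S"] by simp
  define E where "E h = {\<omega> \<in> space M. \<forall>j\<le>k. Y j \<omega> = h j}" for h
  have Em [measurable]: "E h \<in> sets M" for h unfolding E_def by measurable
  have E_eq: "\<omega> \<in> E h \<longleftrightarrow> \<omega> \<in> space M \<and> (\<lambda>j\<in>{..k}. Y j \<omega>) = h" if "h \<in> D" for h \<omega>
  proof -
    have "h \<in> extensional {..k}" using that by (auto simp: D_def PiE_def)
    then have "h = restrict h {..k}" by (simp add: extensional_restrict)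
    then show ?thesis by (auto simp: E_def fun_eq_iff restrict_def) metis+
  qed
  have disj: "disjoint_family_on E D" by (auto simp: disjoint_family_on_def E_eq)
  define A where "A = {\<omega> \<in> space M. Y (Suc k) \<omega> = s}"
  have Am [measurable]: "A \<in> sets M" unfolding A_def using s by measurable
  have UE: "{\<omega> \<in> space M. Y k \<omega> = y \<and> (\<lambda>j\<in>{..k}. Y j \<omega>) \<in> H} = (\<Union>h\<in>D. E h)"
  proof (intro set_eqI iffI)
    fix \<omega> assume "\<omega> \<in> {\<omega> \<in> space M. Y k \<omega> = y \<and> (\<lambda>j\<in>{..k}. Y j \<omega>) \<in> H}"
    then have "(\<lambda>j\<in>{..k}. Y j \<omega>) \<in> D" "\<omega> \<in> E (\<lambda>j\<in>{..k}. Y j \<omega>)"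
      using YS by (auto simp: D_def E_def)
    then show "\<omega> \<in> (\<Union>h\<in>D. E h)" by blast
  next
    fix \<omega> assume "\<omega> \<in> (\<Union>h\<in>D. E h)"
    then obtain h where h: "h \<in> D" "\<omega> \<in> E h" by blast
    then show "\<omega> \<in> {\<omega> \<in> space M. Y k \<omega> = y \<and> (\<lambda>j\<in>{..k}. Y j \<omega>) \<in> H}"
      using E_eq[OF h(1)] by (auto simp: D_def E_def)
  qed
  \<comment> \<open>Histories of probability zero are outside the scope of the Markov property, but
    then both sides vanish.\<close>
  have step: "prob (A \<inter> E h) = ?p * prob (E h)" if h: "h \<in> D" for h
  proof (cases "prob (E h) > 0")
    case True
    have "\<P>(\<omega> in M. Y (Suc k) \<omega> = s \<bar> \<forall>j\<le>k. Y j \<omega> = h j) =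
          \<P>(\<omega> in M. Y (Suc k) \<omega> = s \<bar> Y k \<omega> = h k)"
      using mc h s True by (auto simp: markov_chain_def D_def E_def)
    moreover have "{\<omega> \<in> space M. Y (Suc k) \<omega> = s \<and> (\<forall>j\<le>k. Y j \<omega> = h j)} = A \<inter> E h"
      by (auto simp: A_def E_def)
    ultimately show ?thesis using True h unfolding cond_prob_def
      by (simp add: E_def D_def field_simps)
  next
    case False
    then have "prob (E h) = 0" using measure_nonneg[of M "E h"] by linarith
    moreover have "prob (A \<inter> E h) \<le> prob (E h)" by (intro finite_measure_mono) auto
    ultimately show ?thesis using measure_nonneg[of M "A \<inter> E h"] by simp
  qed
  have "{\<omega> \<in> space M. Y (Suc k) \<omega> = s \<and> Y k \<omega> = y \<and> (\<lambda>j\<in>{..k}. Y j \<omega>) \<in> H} =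
          (\<Union>h\<in>D. A \<inter> E h)"
    using UE by (auto simp: A_def)
  then have "\<P>(\<omega> in M. Y (Suc k) \<omega> = s \<and> Y k \<omega> = y \<and> (\<lambda>j\<in>{..k}. Y j \<omega>) \<in> H) =
          (\<Sum>h\<in>D. prob (A \<inter> E h))"
    using finD disj
    by (simp only:, intro finite_measure_finite_Union) (auto simp: disjoint_family_on_def)
  also have "\<dots> = ?p * (\<Sum>h\<in>D. prob (E h))" by (simp add: step sum_distrib_left)
  also have "(\<Sum>h\<in>D. prob (E h)) = \<P>(\<omega> in M. Y k \<omega> = y \<and> (\<lambda>j\<in>{..k}. Y j \<omega>) \<in> H)"
    unfolding UE using finD disj by (intro finite_measure_finite_Union[symmetric]) auto
  finally show ?thesis .
qed

section \<open>The joint law of the state and the number of preceding ones\<close>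

lemma two_state_chain_measurable:
  assumes "two_state_chain M q c Y"
  shows "Y k \<in> M \<rightarrow>\<^sub>M count_space UNIV" "ones_before Y k \<in> M \<rightarrow>\<^sub>M count_space UNIV"
proof -
  have "(\<lambda>x. x) \<circ> Y k \<in> M \<rightarrow>\<^sub>M count_space UNIV" for k
  proof (rule measurable_comp)
    show "Y k \<in> M \<rightarrow>\<^sub>M count_space {0, 1}"
      using assms by (simp add: two_state_chain_def markov_chain_def)
  qed simp
  then show [measurable]: "Y k \<in> M \<rightarrow>\<^sub>M count_space UNIV" for k
    by (simp add: comp_def)
  show "ones_before Y k \<in> M \<rightarrow>\<^sub>M count_space UNIV"
    unfolding ones_before_def[abs_def] by measurable
qed

lemma two_state_chain_values:
  assumes "two_state_chain M q c Y" "\<omega> \<in> space M"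
  shows "Y k \<omega> \<in> {0, 1}"
  using assms measurable_space[of "Y k" M "count_space {0, 1}" \<omega>]
  by (simp add: two_state_chain_def markov_chain_def)

lemma two_state_chain_prob_space: "two_state_chain M q c Y \<Longrightarrow> prob_space M"
  by (simp add: two_state_chain_def markov_chain_def)

definition state_ones_prob :: "'a measure \<Rightarrow> (nat \<Rightarrow> 'a \<Rightarrow> nat) \<Rightarrow> nat \<Rightarrow> nat \<Rightarrow> nat \<Rightarrow> real" where
  "state_ones_prob M Y j y l = \<P>(\<omega> in M. Y j \<omega> = y \<and> ones_before Y j \<omega> = l)"

text \<open>
  The number of ones before \<open>k\<close> is a function of the history up to \<open>k\<close>, so the chain jumps with
  its transition probability independently of this number. If the state \<open>y\<close> has probability
  zero at time \<open>k\<close>, the transition probability is not determined by the chain, but both sides are zero.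
\<close>

lemma two_state_chain_jump:
  assumes ch: "two_state_chain M q c Y" and y: "y \<in> {0, 1}"
  shows "\<P>(\<omega> in M. Y (Suc k) \<omega> = 1 - y \<and> Y k \<omega> = y \<and> ones_before Y k \<omega> = l) =
         q (1 - y) * state_ones_prob M Y k y l"
proof -
  interpret prob_space M by (rule two_state_chain_prob_space[OF ch])
  note [measurable] = two_state_chain_measurable[OF ch]
  have mc: "markov_chain M {0, 1} Y" using ch by (simp add: two_state_chain_def)
  define H where "H = {h :: nat \<Rightarrow> nat. (\<Sum>j<k. h j) = l}"
  have H: "(\<lambda>j\<in>{..k}. Y j \<omega>) \<in> H \<longleftrightarrow> ones_before Y k \<omega> = l" for \<omega>
    by (simp add: H_def ones_before_def)
  have fact: "\<P>(\<omega> in M. Y (Suc k) \<omega> = 1 - y \<and> Y k \<omega> = y \<and> ones_before Y k \<omega> = l) =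
         \<P>(\<omega> in M. Y (Suc k) \<omega> = 1 - y \<bar> Y k \<omega> = y) * state_ones_prob M Y k y l"
    using markov_chain_history[OF mc _, of "1 - y" k y H] y
    unfolding H state_ones_prob_def by auto
  show ?thesis
  proof (cases "\<P>(\<omega> in M. Y k \<omega> = y) > 0")
    case True
    then have "\<P>(\<omega> in M. Y (Suc k) \<omega> = 1 - y \<bar> Y k \<omega> = y) = q (1 - y)"
      using ch y by (auto simp: two_state_chain_def)
    then show ?thesis using fact by simp
  next
    case False
    then have "\<P>(\<omega> in M. Y k \<omega> = y) = 0"
      using measure_nonneg[of M "{\<omega> \<in> space M. Y k \<omega> = y}"] by linarith
    moreover have "state_ones_prob M Y k y l \<le> \<P>(\<omega> in M. Y k \<omega> = y)"
      unfolding state_ones_prob_def using y by (intro finite_measure_mono) auto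
    ultimately have "state_ones_prob M Y k y l = 0"
      by (simp add: state_ones_prob_def measure_le_0_iff)
    then show ?thesis using fact by simp
  qed
qed

lemma two_state_chain_stay:
  assumes ch: "two_state_chain M q c Y" and y: "y \<in> {0, 1}"
  shows "\<P>(\<omega> in M. Y (Suc k) \<omega> = y \<and> Y k \<omega> = y \<and> ones_before Y k \<omega> = l) =
         (1 - q (1 - y)) * state_ones_prob M Y k y l"
proof -
  interpret prob_space M by (rule two_state_chain_prob_space[OF ch])
  note [measurable] = two_state_chain_measurable[OF ch]
  have "state_ones_prob M Y k y l =
      prob ({\<omega> \<in> space M. Y (Suc k) \<omega> = y \<and> Y k \<omega> = y \<and> ones_before Y k \<omega> = l} \<union>
            {\<omega> \<in> space M. Y (Suc k) \<omega> = 1 - y \<and> Y k \<omega> = y \<and> ones_before Y k \<omega> = l})"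
    unfolding state_ones_prob_def
  proof (intro arg_cong[where f = prob] set_eqI)
    fix \<omega>
    show "\<omega> \<in> {\<omega> \<in> space M. Y k \<omega> = y \<and> ones_before Y k \<omega> = l} \<longleftrightarrow>
      \<omega> \<in> {\<omega> \<in> space M. Y (Suc k) \<omega> = y \<and> Y k \<omega> = y \<and> ones_before Y k \<omega> = l} \<union>
            {\<omega> \<in> space M. Y (Suc k) \<omega> = 1 - y \<and> Y k \<omega> = y \<and> ones_before Y k \<omega> = l}"
      using two_state_chain_values[OF ch, of \<omega> "Suc k"] y by auto
  qed
  also have "\<dots> = \<P>(\<omega> in M. Y (Suc k) \<omega> = y \<and> Y k \<omega> = y \<and> ones_before Y k \<omega> = l) +
      \<P>(\<omega> in M. Y (Suc k) \<omega> = 1 - y \<and> Y k \<omega> = y \<and> ones_before Y k \<omega> = l)"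
    using y by (intro finite_measure_Union) auto
  finally show ?thesis
    unfolding two_state_chain_jump[OF ch y] by (simp add: algebra_simps)
qed

text \<open>
  One step of the chain: \<open>l + 1\<close> ones before \<open>Suc k\<close> arise from \<open>Y k = 0\<close> with \<open>l + 1\<close> ones before \<open>k\<close>, or
  from \<open>Y k = 1\<close> with \<open>l\<close> ones before \<open>k\<close>.
\<close>

lemma state_ones_prob_Suc:
  assumes ch: "two_state_chain M q c Y"
  shows "state_ones_prob M Y (Suc k) 0 0 = (1 - q 1) * state_ones_prob M Y k 0 0"
    and "state_ones_prob M Y (Suc k) 1 0 = q 1 * state_ones_prob M Y k 0 0"
    and "state_ones_prob M Y (Suc k) 0 (Suc l) =
           (1 - q 1) * state_ones_prob M Y k 0 (Suc l) + q 0 * state_ones_prob M Y k 1 l"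
    and "state_ones_prob M Y (Suc k) 1 (Suc l) =
           q 1 * state_ones_prob M Y k 0 (Suc l) + (1 - q 0) * state_ones_prob M Y k 1 l"
proof -
  interpret prob_space M by (rule two_state_chain_prob_space[OF ch])
  note [measurable] = two_state_chain_measurable[OF ch]
  have zero: "state_ones_prob M Y (Suc k) y 0 =
      \<P>(\<omega> in M. Y (Suc k) \<omega> = y \<and> Y k \<omega> = 0 \<and> ones_before Y k \<omega> = 0)" for y
    unfolding state_ones_prob_def
  proof (intro arg_cong[where f = prob] Collect_cong)
    fix \<omega>
    show "(\<omega> \<in> space M \<and> Y (Suc k) \<omega> = y \<and> ones_before Y (Suc k) \<omega> = 0) \<longleftrightarrow>
          (\<omega> \<in> space M \<and> Y (Suc k) \<omega> = y \<and> Y k \<omega> = 0 \<and> ones_before Y k \<omega> = 0)"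
      by (auto simp: ones_before_Suc)
  qed
  have suc: "state_ones_prob M Y (Suc k) y (Suc l) =
      \<P>(\<omega> in M. Y (Suc k) \<omega> = y \<and> Y k \<omega> = 0 \<and> ones_before Y k \<omega> = Suc l) +
      \<P>(\<omega> in M. Y (Suc k) \<omega> = y \<and> Y k \<omega> = 1 \<and> ones_before Y k \<omega> = l)" for y
  proof -
    have "state_ones_prob M Y (Suc k) y (Suc l) =
      prob ({\<omega> \<in> space M. Y (Suc k) \<omega> = y \<and> Y k \<omega> = 0 \<and> ones_before Y k \<omega> = Suc l} \<union>
            {\<omega> \<in> space M. Y (Suc k) \<omega> = y \<and> Y k \<omega> = 1 \<and> ones_before Y k \<omega> = l})"
      unfolding state_ones_prob_def
    proof (intro arg_cong[where f = prob] set_eqI)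
      fix \<omega>
      show "\<omega> \<in> {\<omega> \<in> space M. Y (Suc k) \<omega> = y \<and> ones_before Y (Suc k) \<omega> = Suc l} \<longleftrightarrow>
        \<omega> \<in> {\<omega> \<in> space M. Y (Suc k) \<omega> = y \<and> Y k \<omega> = 0 \<and> ones_before Y k \<omega> = Suc l} \<union>
              {\<omega> \<in> space M. Y (Suc k) \<omega> = y \<and> Y k \<omega> = 1 \<and> ones_before Y k \<omega> = l}"
        using two_state_chain_values[OF ch, of \<omega> k] by (auto simp: ones_before_Suc)
    qed
    also have "\<dots> = \<P>(\<omega> in M. Y (Suc k) \<omega> = y \<and> Y k \<omega> = 0 \<and> ones_before Y k \<omega> = Suc l) +
      \<P>(\<omega> in M. Y (Suc k) \<omega> = y \<and> Y k \<omega> = 1 \<and> ones_before Y k \<omega> = l)"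
      by (intro finite_measure_Union) auto
    finally show ?thesis .
  qed
  note jump = two_state_chain_jump[OF ch, of 0] two_state_chain_jump[OF ch, of 1]
    and stay = two_state_chain_stay[OF ch, of 0] two_state_chain_stay[OF ch, of 1]
  show "state_ones_prob M Y (Suc k) 0 0 = (1 - q 1) * state_ones_prob M Y k 0 0"
    using zero[of 0] stay(1)[of k 0] by simp
  show "state_ones_prob M Y (Suc k) 1 0 = q 1 * state_ones_prob M Y k 0 0"
    using zero[of 1] jump(1)[of k 0] by simp
  show "state_ones_prob M Y (Suc k) 0 (Suc l) =
           (1 - q 1) * state_ones_prob M Y k 0 (Suc l) + q 0 * state_ones_prob M Y k 1 l"
    using suc[of 0] stay(1)[of k "Suc l"] jump(2)[of k l] by simp
  show "state_ones_prob M Y (Suc k) 1 (Suc l) =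
           q 1 * state_ones_prob M Y k 0 (Suc l) + (1 - q 0) * state_ones_prob M Y k 1 l"
    using suc[of 1] jump(1)[of k "Suc l"] stay(2)[of k l] by simp
qed

lemma state_ones_prob_init:
  assumes ch: "two_state_chain M q c Y"
  shows "state_ones_prob M Y 0 0 0 = 1 - c" "state_ones_prob M Y 0 1 0 = c"
    "state_ones_prob M Y 0 y (Suc l) = 0"
proof -
  interpret prob_space M by (rule two_state_chain_prob_space[OF ch])
  note [measurable] = two_state_chain_measurable[OF ch]
  show one: "state_ones_prob M Y 0 1 0 = c"
    using ch by (simp add: state_ones_prob_def two_state_chain_def)
  have "{\<omega> \<in> space M. Y 0 \<omega> = 0} = space M - {\<omega> \<in> space M. Y 0 \<omega> = 1}"
    by (auto dest: two_state_chain_values[OF ch, where k = 0])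
  then have "\<P>(\<omega> in M. Y 0 \<omega> = 0) = 1 - \<P>(\<omega> in M. Y 0 \<omega> = 1)"
    by (simp add: prob_compl)
  then show "state_ones_prob M Y 0 0 0 = 1 - c"
    using one by (simp add: state_ones_prob_def)
  show "state_ones_prob M Y 0 y (Suc l) = 0"
    by (simp add: state_ones_prob_def)
qed

section \<open>The expected number of wasted slots\<close>

text \<open>
  Rewriting the recurrence as \<open>q * u j = u j - u (Suc j) + v j\<close> makes the partial sums telescope.
  As \<open>u\<close> is non-negative they are bounded, so \<open>u\<close> is summable, tends to zero, and the boundary term
  \<open>u n\<close> disappears in the limit.
\<close>

lemma sums_linear_recurrence:
  fixes u v :: "nat \<Rightarrow> real"
  assumes q: "q > 0" and u: "\<And>j. u j \<ge> 0" and v: "\<And>j. v j \<ge> 0"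
    and rec: "\<And>j. u (Suc j) = (1 - q) * u j + v j" and V: "v sums V"
  shows "u sums ((u 0 + V) / q)"
proof -
  have tele: "q * (\<Sum>j<n. u j) = u 0 - u n + (\<Sum>j<n. v j)" for n
    by (induction n) (auto simp: rec algebra_simps)
  have "(\<Sum>j<n. u j) \<le> (u 0 + V) / q" for n
  proof -
    have "(\<Sum>j<n. v j) \<le> V"
      using V v by (metis sum_le_suminf sums_iff finite_lessThan)
    then have "q * (\<Sum>j<n. u j) \<le> u 0 + V" using tele[of n] u[of n] by linarith
    then show ?thesis using q by (simp add: field_simps)
  qed
  then have sm: "summable u" using u by (intro summableI_nonneg_bounded) auto
  have "(\<lambda>n. (u 0 - u n + (\<Sum>j<n. v j)) / q) \<longlonglongrightarrow> (u 0 - 0 + V) / q"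
    using summable_LIMSEQ_zero[OF sm] V q unfolding sums_def by (intro tendsto_intros) auto
  moreover have "(\<Sum>j<n. u j) = (u 0 - u n + (\<Sum>j<n. v j)) / q" for n
    using tele[of n] q by (simp add: field_simps)
  ultimately show ?thesis by (simp add: sums_def)
qed

text \<open>
  The first sum is the expected length of the unavailable period between the \<open>l\<close>-th and the
  \<open>(l + 1)\<close>-st one, and the second is the probability that an \<open>(l + 1)\<close>-st one ever occurs. The two are
  proved together: the \<open>l\<close>-th one is what starts the period after it, and the end of the period,
  reached because \<open>q 1 > 0\<close>, is the next one.
\<close>

lemma state_ones_prob_sums:
  assumes ch: "two_state_chain M q c Y" and q1: "q 1 > 0" and q0: "0 \<le> q 0"
  shows "(\<lambda>j. state_ones_prob M Y j 0 l) sums (if l = 0 then (1 - c) / q 1 else q 0 / q 1)"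
    and "(\<lambda>j. state_ones_prob M Y j 1 l) sums 1"
proof -
  have nonneg: "state_ones_prob M Y j y l \<ge> 0" for j y l by (simp add: state_ones_prob_def)
  have "(\<lambda>j. state_ones_prob M Y j 0 l) sums (if l = 0 then (1 - c) / q 1 else q 0 / q 1) \<and>
        (\<lambda>j. state_ones_prob M Y j 1 l) sums 1"
  proof (induction l)
    case 0
    have A: "(\<lambda>j. state_ones_prob M Y j 0 0) sums ((1 - c) / q 1)"
      using sums_linear_recurrence[of "q 1" "\<lambda>j. state_ones_prob M Y j 0 0" "\<lambda>_. 0" 0]
        q1 nonneg state_ones_prob_Suc[OF ch] state_ones_prob_init[OF ch] by simp
    have "(\<lambda>j. state_ones_prob M Y (Suc j) 1 0) sums (q 1 * ((1 - c) / q 1))"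
      unfolding state_ones_prob_Suc[OF ch] by (rule sums_mult[OF A])
    then have "(\<lambda>j. state_ones_prob M Y j 1 0) sums
        (q 1 * ((1 - c) / q 1) + state_ones_prob M Y 0 1 0)"
      by (rule sums_Suc)
    then show ?case using A q1 by (simp add: state_ones_prob_init[OF ch, simplified])
  next
    case (Suc l)
    then have B: "(\<lambda>j. state_ones_prob M Y j 1 l) sums 1" by blast
    have A: "(\<lambda>j. state_ones_prob M Y j 0 (Suc l)) sums (q 0 / q 1)"
      using sums_linear_recurrence[of "q 1" "\<lambda>j. state_ones_prob M Y j 0 (Suc l)"
          "\<lambda>j. q 0 * state_ones_prob M Y j 1 l" "q 0"]
        q1 q0 nonneg state_ones_prob_Suc(3)[OF ch] state_ones_prob_init(3)[OF ch]
        sums_mult[OF B, of "q 0"] by simp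
    have "(\<lambda>j. state_ones_prob M Y (Suc j) 1 (Suc l)) sums
        (q 1 * (q 0 / q 1) + (1 - q 0) * 1)"
      unfolding state_ones_prob_Suc(4)[OF ch] by (intro sums_add sums_mult A B)
    then have "(\<lambda>j. state_ones_prob M Y j 1 (Suc l)) sums
        (q 1 * (q 0 / q 1) + (1 - q 0) * 1 + state_ones_prob M Y 0 1 (Suc l))"
      by (rule sums_Suc)
    then show ?case using A q1 by (simp add: state_ones_prob_init(3)[OF ch])
  qed
  then show "(\<lambda>j. state_ones_prob M Y j 0 l) sums (if l = 0 then (1 - c) / q 1 else q 0 / q 1)"
    "(\<lambda>j. state_ones_prob M Y j 1 l) sums 1" by auto
qed

lemma expected_wasted_slots:
  assumes ch: "two_state_chain M q c Y" and q1: "q 1 > 0" and q0: "0 \<le> q 0"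
  shows "(\<lambda>\<omega>. \<Sum>j. of_bool (Y j \<omega> = 0 \<and> ones_before Y j \<omega> \<le> m) :: ennreal) \<in> borel_measurable M"
    and "(\<integral>\<^sup>+ \<omega>. (\<Sum>j. of_bool (Y j \<omega> = 0 \<and> ones_before Y j \<omega> \<le> m)) \<partial>M) =
           ennreal ((1 - c) / q 1 + real m * (q 0 / q 1))"
proof -
  interpret prob_space M by (rule two_state_chain_prob_space[OF ch])
  note [measurable] = two_state_chain_measurable[OF ch]
  have ind: "of_bool (Y j \<omega> = 0 \<and> ones_before Y j \<omega> \<le> m) =
      (indicator {\<omega> \<in> space M. Y j \<omega> = 0 \<and> ones_before Y j \<omega> \<le> m} \<omega> :: ennreal)"
    if "\<omega> \<in> space M" for j \<omega> using that by (simp add: indicator_def)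
  have bm [measurable]: "(\<lambda>\<omega>. of_bool (Y j \<omega> = 0 \<and> ones_before Y j \<omega> \<le> m) :: ennreal)
      \<in> borel_measurable M" for j
    by (subst measurable_cong[OF ind]) auto
  show "(\<lambda>\<omega>. \<Sum>j. of_bool (Y j \<omega> = 0 \<and> ones_before Y j \<omega> \<le> m) :: ennreal) \<in> borel_measurable M"
    by measurable
  have slot: "(\<integral>\<^sup>+ \<omega>. of_bool (Y j \<omega> = 0 \<and> ones_before Y j \<omega> \<le> m) \<partial>M) =
      ennreal (\<Sum>l\<le>m. state_ones_prob M Y j 0 l)" for j
  proof -
    have "{\<omega> \<in> space M. Y j \<omega> = 0 \<and> ones_before Y j \<omega> \<le> m} =
        (\<Union>l\<in>{..m}. {\<omega> \<in> space M. Y j \<omega> = 0 \<and> ones_before Y j \<omega> = l})" by auto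
    then have "prob {\<omega> \<in> space M. Y j \<omega> = 0 \<and> ones_before Y j \<omega> \<le> m} =
        (\<Sum>l\<le>m. state_ones_prob M Y j 0 l)"
      unfolding state_ones_prob_def
      by (simp only:, intro finite_measure_finite_Union) (auto simp: disjoint_family_on_def)
    then show ?thesis
      by (simp add: nn_integral_cong[OF ind] emeasure_eq_measure)
  qed
  have "(\<lambda>j. \<Sum>l\<le>m. state_ones_prob M Y j 0 l) sums
      (\<Sum>l\<le>m. if l = 0 then (1 - c) / q 1 else q 0 / q 1)"
    by (intro sums_sum state_ones_prob_sums[OF assms])
  also have "(\<Sum>l\<le>m. if l = 0 then (1 - c) / q 1 else q 0 / q 1) =
      (1 - c) / q 1 + real m * (q 0 / q 1)"
    by (subst sum.atMost_shift) simp
  finally have "(\<Sum>j. ennreal (\<Sum>l\<le>m. state_ones_prob M Y j 0 l)) =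
      ennreal ((1 - c) / q 1 + real m * (q 0 / q 1))"
    by (intro suminf_ennreal_eq) (auto intro!: sum_nonneg simp: state_ones_prob_def)
  then show "(\<integral>\<^sup>+ \<omega>. (\<Sum>j. of_bool (Y j \<omega> = 0 \<and> ones_before Y j \<omega> \<le> m)) \<partial>M) =
           ennreal ((1 - c) / q 1 + real m * (q 0 / q 1))"
    by (simp add: nn_integral_suminf slot)
qed

theorem proposition7p1:
  fixes M :: "'a measure" and N :: nat and \<Delta> :: real
    and r c :: "nat \<Rightarrow> real" and q :: "nat \<Rightarrow> nat \<Rightarrow> real"
    and Y :: "nat \<Rightarrow> nat \<Rightarrow> 'a \<Rightarrow> nat"
    and F :: real and i :: nat
  assumes "prob_space M"
    and "\<Delta> > 0"
    and "\<And>j. j \<in> {1..N} \<Longrightarrow> r j > 0"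
    and "\<And>j. j \<in> {1..N} \<Longrightarrow> q j 1 \<in> {0<..1}"
    and "\<And>j. j \<in> {1..N} \<Longrightarrow> q j 0 \<in> {0..1}"
    and "\<And>j. j \<in> {1..N} \<Longrightarrow> c j \<in> {0..1}"
    and "\<And>j. j \<in> {1..N} \<Longrightarrow> two_state_chain M (q j) (c j) (Y j)"
    and "F > 0"
    and "i \<in> {1..N}"
  shows "let k = \<lfloor>F / (\<Delta> * r i)\<rfloor>; \<alpha> = F / (\<Delta> * r i) - of_int k in
    transfer_time \<Delta> (r i) (Y i) F \<in> borel_measurable M \<and>
    (\<integral>\<^sup>+ \<omega>. transfer_time \<Delta> (r i) (Y i) F \<omega> \<partial>M) =
      ennreal (\<Delta> * ((of_int k + of_bool (\<alpha> > 0) - 1) * (q i 0 / q i 1) + (1 - c i) / q i 1)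
        + F / r i)"
proof -
  let ?x = "F / (\<Delta> * r i)"
  \<comment> \<open>The number of available slots that are used completely before the one that completes the file;
    it is \<open>k - 1\<close> rather than \<open>k\<close> if \<open>F\<close> fills \<open>k\<close> slots exactly.\<close>
  define m where "m = nat (\<lceil>?x\<rceil> - 1)"
  note i = \<open>i \<in> {1..N}\<close>
  have \<Delta>: "\<Delta> > 0" and \<rho>: "r i > 0" and q1: "q i 1 > 0" and q0: "q i 0 \<ge> 0"
    and c1: "c i \<le> 1" and ch: "two_state_chain M (q i) (c i) (Y i)"
    using assms i by auto
  have x: "?x > 0" using \<Delta> \<rho> \<open>F > 0\<close> by simp
  then have "\<lceil>?x\<rceil> \<ge> 1" by linarith
  then have m: "of_int \<lceil>?x\<rceil> = real m + 1" by (simp add: m_def)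
  have "real m < ?x" "?x \<le> real (Suc m)" using m by linarith+
  then have mF: "real m * (\<Delta> * r i) < F" "F \<le> real (Suc m) * (\<Delta> * r i)"
    using \<Delta> \<rho> by (simp_all add: field_simps)
  have eq: "transfer_time \<Delta> (r i) (Y i) F \<omega> =
      ennreal (F / r i) + ennreal \<Delta> * (\<Sum>j. of_bool (Y i j \<omega> = 0 \<and> ones_before (Y i) j \<omega> \<le> m))"
    if "\<omega> \<in> space M" for \<omega>
    by (intro transfer_time_eq_wasted_slots \<Delta> \<rho> mF two_state_chain_values[OF ch that])
  note Z = expected_wasted_slots[OF ch q1 q0, of m]
  note Z(1)[measurable]
  have meas: "transfer_time \<Delta> (r i) (Y i) F \<in> borel_measurable M"
    by (subst measurable_cong[OF eq]) auto
  interpret prob_space M by fact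
  have "(\<integral>\<^sup>+ \<omega>. transfer_time \<Delta> (r i) (Y i) F \<omega> \<partial>M) =
      ennreal (F / r i) + ennreal \<Delta> * ennreal ((1 - c i) / q i 1 + real m * (q i 0 / q i 1))"
    by (simp add: nn_integral_cong[OF eq] nn_integral_add nn_integral_cmult Z(2) emeasure_space_1)
  also have "\<dots> = ennreal (F / r i + \<Delta> * ((1 - c i) / q i 1 + real m * (q i 0 / q i 1)))"
    using \<Delta> \<rho> \<open>F > 0\<close> q1 q0 c1 by (simp add: ennreal_plus ennreal_mult)
  also have "real m = of_int \<lfloor>?x\<rfloor> + of_bool (?x - of_int \<lfloor>?x\<rfloor> > 0) - 1"
    using m by (simp add: ceiling_altdef split: if_splits) linarith
  finally have val: "(\<integral>\<^sup>+ \<omega>. transfer_time \<Delta> (r i) (Y i) F \<omega> \<partial>M) =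
      ennreal (F / r i + \<Delta> * ((1 - c i) / q i 1
        + (of_int \<lfloor>?x\<rfloor> + of_bool (?x - of_int \<lfloor>?x\<rfloor> > 0) - 1) * (q i 0 / q i 1)))" .
  show ?thesis unfolding Let_def using meas val by (simp only: add_ac simp_thms)
qed

end
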